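(* Let $\lambda\in\mathbb{C}$ with $\Im(\lambda)>0$ and let $f_\lambda(z)=\lambda+z+\tan z$. Then there is a completely invariant Baker domain $B_\lambda$ of $f_\lambda$ containing the upper half-plane $\{z\in\mathbb{C}:\Im(z)>0\}$.
   Context: For a transcendental meromorphic function $f:\mathbb{C}\to\widehat{\mathbb{C}}$, the Fatou set $\mathcal{F}(f)$ is the set of points having a neighborhood on which all iterates $f^n$, $n>0$, are defined and form a normal family. A Fatou component is a maximal connected subset of $\mathcal{F}(f)$. For a Fatou component $U$, $U_n$ denotes the Fatou component containing $f^n(U)$; $U$ is invariant if $U_1=U$, and an invariant $U$ is completely invariant if moreover $f^{-1}(U)\subseteq U$. An invariant Fatou component $U$ is a Baker domain if $f^n\to\infty$ uniformly on every compact subset of $U$, where $\infty$ is the essential singularity of $f$. *)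

theory Defs
  imports "HOL-Complex_Analysis.Complex_Analysis"
begin

text \<open>The Riemann sphere is modelled by \<^typ>\<open>complex option\<close>, with \<^term>\<open>None\<close> as the point
  at infinity; its topology and uniform structure are those of the chordal metric, i.e. the
  Euclidean distance of the stereographic projections to the unit sphere.\<close>

fun chordal :: "complex option \<Rightarrow> complex option \<Rightarrow> real" where
  "chordal (Some z) (Some w) =
     2 * cmod (z - w) / (sqrt (1 + (cmod z)\<^sup>2) * sqrt (1 + (cmod w)\<^sup>2))"
| "chordal (Some z) None = 2 / sqrt (1 + (cmod z)\<^sup>2)"
| "chordal None (Some w) = 2 / sqrt (1 + (cmod w)\<^sup>2)"
| "chordal None None = 0"

text \<open>HOL functions are total, so a meromorphic function has some arbitrary complex value at its
  poles. The associated map into the sphere takes the value infinity there.\<close>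

definition sphere_map :: "(complex \<Rightarrow> complex) \<Rightarrow> complex \<Rightarrow> complex option" where
  "sphere_map f z = (if is_pole f z then None else Some (f z))"

text \<open>For a meromorphic map on the plane whose poles may accumulate at infinity, infinity is called
  an essential singularity if there is no limit in the sphere there; this happens exactly for the
  transcendental (i.e. non-rational) maps.\<close>

definition essential_singularity_at_infinity :: "(complex \<Rightarrow> complex option) \<Rightarrow> bool" where
  "essential_singularity_at_infinity f \<longleftrightarrow>
     \<not> (\<exists>l. ((\<lambda>z. chordal (f z) l) \<longlongrightarrow> 0) at_infinity)"

text \<open>The map \<^term>\<open>f\<close> is not defined at infinity. Hence the iterate of order \<^term>\<open>n\<close> is defined
  at \<^term>\<open>z\<close> (with values in the sphere) iff all iterates of smaller order are finite at
  \<^term>\<open>z\<close>; where it is undefined, \<^term>\<open>iterate f n z\<close> has the junk value \<^term>\<open>None\<close>.\<close>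

primrec iterate :: "(complex \<Rightarrow> complex option) \<Rightarrow> nat \<Rightarrow> complex \<Rightarrow> complex option" where
  "iterate f 0 z = Some z"
| "iterate f (Suc n) z = Option.bind (iterate f n z) f"

definition iterate_defined :: "(complex \<Rightarrow> complex option) \<Rightarrow> nat \<Rightarrow> complex \<Rightarrow> bool" where
  "iterate_defined f n z \<longleftrightarrow> (\<forall>m<n. iterate f m z \<noteq> None)"

text \<open>As usual, the limit function in the definition of normality may take the value infinity.\<close>

definition normal_family :: "complex set \<Rightarrow> (complex \<Rightarrow> complex option) set \<Rightarrow> bool" where
  "normal_family V F \<longleftrightarrow>
     (\<forall>s :: nat \<Rightarrow> complex \<Rightarrow> complex option. range s \<subseteq> F \<longrightarrow>
        (\<exists>(r :: nat \<Rightarrow> nat) g. strict_mono r \<and>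
           (\<forall>K. compact K \<and> K \<subseteq> V \<longrightarrow>
              uniform_limit K (\<lambda>n z. chordal (s (r n) z) (g z)) (\<lambda>_. 0) sequentially)))"

definition fatou_set :: "(complex \<Rightarrow> complex option) \<Rightarrow> complex set" where
  "fatou_set f = {z. \<exists>V. open V \<and> z \<in> V \<and>
     (\<forall>n>0. \<forall>w\<in>V. iterate_defined f n w) \<and> normal_family V {iterate f n |n. n > 0}}"

text \<open>In the following, \<^term>\<open>is_fatou_image f n U V\<close> says that \<^term>\<open>V\<close> is the Fatou component
  (necessarily unique, as \<^term>\<open>U\<close> is nonempty and distinct components are disjoint) that contains
  the image of \<^term>\<open>U\<close> under the iterate of order \<^term>\<open>n\<close>.\<close>

definition fatou_component :: "(complex \<Rightarrow> complex option) \<Rightarrow> complex set \<Rightarrow> bool" where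
  "fatou_component f U \<longleftrightarrow> U \<in> components (fatou_set f)"

definition is_fatou_image ::
    "(complex \<Rightarrow> complex option) \<Rightarrow> nat \<Rightarrow> complex set \<Rightarrow> complex set \<Rightarrow> bool" where
  "is_fatou_image f n U V \<longleftrightarrow> fatou_component f V \<and> iterate f n ` U \<subseteq> Some ` V"

definition invariant_component :: "(complex \<Rightarrow> complex option) \<Rightarrow> complex set \<Rightarrow> bool" where
  "invariant_component f U \<longleftrightarrow> fatou_component f U \<and> is_fatou_image f 1 U U"

definition completely_invariant_component ::
    "(complex \<Rightarrow> complex option) \<Rightarrow> complex set \<Rightarrow> bool" where
  "completely_invariant_component f U \<longleftrightarrow> invariant_component f U \<and> f -` (Some ` U) \<subseteq> U"

definition baker_domain :: "(complex \<Rightarrow> complex option) \<Rightarrow> complex set \<Rightarrow> bool" where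
  "baker_domain f U \<longleftrightarrow> invariant_component f U \<and> essential_singularity_at_infinity f \<and>
     (\<forall>K. compact K \<and> K \<subseteq> U \<longrightarrow>
        uniform_limit K (\<lambda>n z. chordal (iterate f n z) None) (\<lambda>_. 0) sequentially)"

definition tan_map :: "complex \<Rightarrow> complex \<Rightarrow> complex option" where
  "tan_map l = sphere_map (\<lambda>z. l + z + tan z)"

lemma tan_map_eq: "tan_map l z = (if cos z = 0 then None else Some (l + z + tan z))"
proof (cases "cos z = 0")
  case True
  then have s: "sin z \<noteq> 0"
    using sin_cos_squared_add[of z] by auto
  have "cos holomorphic_on (UNIV :: complex set)"
    by (intro holomorphic_intros)
  then have "eventually (\<lambda>w. cos w \<noteq> 0) (at z)"
    using non_zero_neighbour_alt[of cos UNIV z 0] by (simp add: connected_UNIV)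
  then have "filterlim cos (at 0) (at z)"
    using isCont_cos[of z] True by (auto simp: filterlim_at isCont_def)
  then have "filterlim (\<lambda>w. sin w / cos w) at_infinity (at z)"
    using isCont_sin[of z] s by (intro filterlim_divide_at_infinity[where c = "sin z"])
      (auto simp: isCont_def)
  then have "is_pole (\<lambda>w. l + w + tan w) z"
    unfolding is_pole_def tan_def
    by (intro tendsto_add_filterlim_at_infinity[where c = "l + z"]) (auto intro!: tendsto_intros)
  with True show ?thesis
    by (simp add: tan_map_def sphere_map_def)
next
  case False
  then have "isCont (\<lambda>w. l + w + tan w) z"
    by (intro continuous_intros) auto
  then have "\<not> is_pole (\<lambda>w. l + w + tan w) z"
    unfolding is_pole_def isCont_def
    using not_tendsto_and_filterlim_at_infinity by (metis at_neq_bot)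
  with False show ?thesis
    by (simp add: tan_map_def sphere_map_def)
qed

end

theory Submission
  imports Defs
begin

text \<open>
  Let \<open>H\<close> be the upper half-plane. Since \<open>Im (tan z)\<close> has the sign of \<open>Im z\<close>, the map sends \<open>H\<close> into
  itself and increases the imaginary part there by at least \<open>Im l\<close>, while below the real axis it
  increases it by at most \<open>Im l\<close>. The domain is the set \<open>B\<close> of all points whose orbit enters \<open>H\<close>; it
  is open, totally invariant, contained in the Fatou set, and on it the iterates escape locally
  uniformly.

  \<open>B\<close> is connected: on a part of the points entering \<open>H\<close> at time \<open>n + 1\<close>, detached from the rest, the
  positive harmonic function \<open>Im f\<^sup>n\<^sup>+\<^sup>1\<close> is bounded by \<open>Im l\<close> and vanishes on the boundary, except at
  the poles of the iterates, so it vanishes by a Phragmen-Lindelof argument.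

  \<open>B\<close> is relatively closed in the Fatou set: near a Fatou point outside \<open>B\<close> the functions
  \<open>exp (- 2 \<i> f\<^sup>n)\<close> omit \<open>0\<close> and \<open>-1\<close> (as the iterates avoid the poles) and have modulus at most \<open>1\<close>
  at that point, so by Schottky's theorem they are uniformly bounded nearby, whereas on \<open>B\<close> they
  tend to infinity. Hence \<open>B\<close> is a Fatou component.
\<close>

section \<open>Imaginary part of the map and domains of its iterates\<close>

text \<open>At a zero of \<open>cos\<close> the quotient \<open>tan z\<close> is 0 by convention, so
  the junk value there is \<open>l + z\<close>; \<open>iter_dom\<close> removes the points whose
  orbit meets such a zero too early.\<close>

definition tan_step :: "complex \<Rightarrow> complex \<Rightarrow> complex" where
  "tan_step l z = l + z + tan z"

definition iter_dom :: "complex \<Rightarrow> nat \<Rightarrow> complex set" where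
  "iter_dom l n = {z. \<forall>m<n. cos ((tan_step l ^^ m) z) \<noteq> 0}"

definition escape :: "complex \<Rightarrow> nat \<Rightarrow> complex set" where
  "escape l n = {z \<in> iter_dom l n. Im ((tan_step l ^^ n) z) > 0}"

text \<open>With \<open>y = Im z\<close> the right-hand side is
  \<open>sinh (2 * y) / (2 * cmod (cos z) ^ 2)\<close>, which makes the sign visible. At a pole both
  sides are 0.\<close>

lemma Im_tan_complex:
  "Im (tan z) = (exp (Im z) ^ 2 - exp (- Im z) ^ 2) / (4 * cmod (cos z) ^ 2)"
proof -
  have eq: "c * (p - q) / 2 * (c * (p + q) / 2) - s * (p + q) / 2 * (s * (q - p) / 2) =
      (c ^ 2 + s ^ 2) * ((p ^ 2 - q ^ 2) / 4)" for c s p q :: real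
    by (simp add: power2_eq_square field_simps)
  have "Im (tan z) = (Im (sin z) * Re (cos z) - Re (sin z) * Im (cos z)) / cmod (cos z) ^ 2"
    by (simp add: tan_def Im_divide cmod_power2)
  also have "Im (sin z) * Re (cos z) - Re (sin z) * Im (cos z) =
      (cos (Re z) ^ 2 + sin (Re z) ^ 2) * ((exp (Im z) ^ 2 - exp (- Im z) ^ 2) / 4)"
    unfolding Im_sin Re_sin Im_cos Re_cos by (rule eq)
  finally show ?thesis by simp
qed

lemma Im_tan_nonneg: "Im z \<ge> 0 \<Longrightarrow> Im (tan z) \<ge> 0"
  by (auto simp: Im_tan_complex intro!: divide_nonneg_nonneg power_mono)

lemma Im_tan_nonpos: "Im z \<le> 0 \<Longrightarrow> Im (tan z) \<le> 0"
  using Im_tan_nonneg[of "- z"] by simp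

lemma Im_tan_step_ge: "Im z \<ge> 0 \<Longrightarrow> Im (tan_step l z) \<ge> Im l + Im z"
  using Im_tan_nonneg[of z] by (simp add: tan_step_def)

lemma Im_tan_step_le: "Im z \<le> 0 \<Longrightarrow> Im (tan_step l z) \<le> Im l + Im z"
  using Im_tan_nonpos[of z] by (simp add: tan_step_def)

lemma cos_nonzero_upper: "Im z > 0 \<Longrightarrow> cos z \<noteq> 0"
  by (auto simp: cos_eq_0)

lemma tan_map_eq_step: "tan_map l z = (if cos z = 0 then None else Some (tan_step l z))"
  by (simp add: tan_map_eq tan_step_def)

lemma iterate_tan_map:
  "iterate (tan_map l) n z = (if z \<in> iter_dom l n then Some ((tan_step l ^^ n) z) else None)"
  by (induction n) (auto simp: iter_dom_def tan_map_eq_step less_Suc_eq)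

lemma iter_dom_0 [simp]: "iter_dom l 0 = UNIV"
  by (simp add: iter_dom_def)

lemma iter_dom_Suc: "iter_dom l (Suc n) = {z \<in> iter_dom l n. cos ((tan_step l ^^ n) z) \<noteq> 0}"
  by (auto simp: iter_dom_def less_Suc_eq)

lemma iter_dom_antimono: "m \<le> n \<Longrightarrow> iter_dom l n \<subseteq> iter_dom l m"
  by (auto simp: iter_dom_def)

text \<open>The two claims support each other: the next domain is where \<open>cos\<close> of the
  current iterate, a continuous function, does not vanish, and there the next iterate is
  holomorphic.\<close>

lemma iter_dom_holomorphic:
  "open (iter_dom l n) \<and> (tan_step l ^^ n) holomorphic_on iter_dom l n"
proof (induction n)
  case 0
  then show ?case by (simp add: id_def)
next
  case (Suc n)
  let ?F = "tan_step l ^^ n"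
  have cont: "continuous_on (iter_dom l n) (\<lambda>z. cos (?F z))"
    using Suc holomorphic_on_imp_continuous_on by (intro continuous_intros) auto
  have "open (iter_dom l n \<inter> (\<lambda>z. cos (?F z)) -` (- {0}))"
    using Suc cont by (intro continuous_open_preimage) auto
  moreover have "iter_dom l n \<inter> (\<lambda>z. cos (?F z)) -` (- {0}) = iter_dom l (Suc n)"
    by (auto simp: iter_dom_Suc)
  moreover have "?F holomorphic_on iter_dom l (Suc n)"
    using Suc by (auto simp: iter_dom_Suc intro: holomorphic_on_subset)
  then have "(\<lambda>z. l + ?F z + sin (?F z) / cos (?F z)) holomorphic_on iter_dom l (Suc n)"
    by (intro holomorphic_intros holomorphic_on_compose[of ?F _ sin, unfolded o_def]
          holomorphic_on_compose[of ?F _ cos, unfolded o_def]) (auto simp: iter_dom_Suc)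
  then have "(tan_step l ^^ Suc n) holomorphic_on iter_dom l (Suc n)"
    by (rule holomorphic_transform) (simp add: tan_step_def tan_def)
  ultimately show ?case
    by metis
qed

lemmas open_iter_dom = iter_dom_holomorphic[THEN conjunct1]
  and holomorphic_iter = iter_dom_holomorphic[THEN conjunct2]

lemma isCont_iter: "z \<in> iter_dom l n \<Longrightarrow> isCont (tan_step l ^^ n) z"
  by (metis continuous_on_eq_continuous_at holomorphic_iter holomorphic_on_imp_continuous_on
      open_iter_dom)

lemma open_escape: "open (escape l n)"
proof -
  have "continuous_on (iter_dom l n) (\<lambda>z. Im ((tan_step l ^^ n) z))"
    by (intro continuous_intros holomorphic_on_imp_continuous_on holomorphic_iter)
  then have "open (iter_dom l n \<inter> (\<lambda>z. Im ((tan_step l ^^ n) z)) -` {0<..})"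
    by (intro continuous_open_preimage open_iter_dom) auto
  moreover have "iter_dom l n \<inter> (\<lambda>z. Im ((tan_step l ^^ n) z)) -` {0<..} = escape l n"
    by (auto simp: escape_def)
  ultimately show ?thesis by simp
qed

lemma escape_0: "escape l 0 = {z. Im z > 0}"
  by (simp add: escape_def)

text \<open>The zeros of \<open>cos\<close> are real, so an orbit in the upper half-plane meets no
  pole, and each step there gains at least \<open>Im l\<close>.\<close>

lemma escape_add:
  assumes "Im l > 0" "z \<in> escape l n"
  shows "z \<in> escape l (n + k) \<and> Im ((tan_step l ^^ (n + k)) z) \<ge> k * Im l"
proof (induction k)
  case 0
  then show ?case using assms by (simp add: escape_def)
next
  case (Suc k)
  let ?w = "(tan_step l ^^ (n + k)) z"
  have pos: "Im ?w > 0" using Suc by (simp add: escape_def)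
  have "Im (tan_step l ?w) \<ge> Im l + Im ?w"
    using pos by (intro Im_tan_step_ge) simp
  then show ?case
    using Suc pos assms cos_nonzero_upper[OF pos]
    by (auto simp: escape_def iter_dom_Suc algebra_simps)
qed

lemma escape_mono: "Im l > 0 \<Longrightarrow> m \<le> n \<Longrightarrow> escape l m \<subseteq> escape l n"
  using escape_add[of l _ m "n - m"] by auto

text \<open>Splits off the first step of the orbit instead of the last; this form yields forward and
  backward invariance.\<close>

lemma iter_dom_Suc_iff: "z \<in> iter_dom l (Suc n) \<longleftrightarrow> cos z \<noteq> 0 \<and> tan_step l z \<in> iter_dom l n"
  unfolding iter_dom_def by (simp add: All_less_Suc2 funpow_swap1)

lemma escape_Suc_iff: "z \<in> escape l (Suc n) \<longleftrightarrow> cos z \<noteq> 0 \<and> tan_step l z \<in> escape l n"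
  unfolding escape_def by (simp add: iter_dom_Suc_iff funpow_swap1)

section \<open>Phragmen-Lindelof argument for detached parts\<close>

text \<open>Maximum principle, with compactness of the superlevel set in place of boundary values. A
  maximum of \<open>norm (G z)\<close> exists; the set where it is attained is closed, and open by
  the maximum modulus principle, so it would be the whole plane, which is not compact.\<close>

lemma no_compact_superlevel_set:
  assumes "open W" "G holomorphic_on W" and comp: "compact {z \<in> W. a \<le> norm (G z)}"
  shows "{z \<in> W. a \<le> norm (G z :: complex)} = {}"
proof (rule ccontr)
  let ?K = "{z \<in> W. a \<le> norm (G z)}"
  assume ne: "?K \<noteq> {}"
  have cont: "continuous_on ?K (\<lambda>z. norm (G z))"
    using assms(2) by (intro continuous_intros holomorphic_on_imp_continuous_on)
      (auto intro: holomorphic_on_subset)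
  obtain w where w: "w \<in> ?K" "\<And>z. z \<in> ?K \<Longrightarrow> norm (G z) \<le> norm (G w)"
    using continuous_attains_sup[OF comp ne cont] by blast
  have w': "norm (G z) \<le> norm (G w)" if "z \<in> W" for z
    using w(1) w(2)[of z] that by fastforce
  let ?M = "{z \<in> W. norm (G z) = norm (G w)}"
  have M: "?M = ?K \<inter> (\<lambda>z. norm (G z)) -` {norm (G w)}"
    using w by auto
  have "closed ?M"
    unfolding M by (intro continuous_closed_preimage cont compact_imp_closed comp) auto
  moreover have "open ?M"
    unfolding open_contains_ball
  proof
    fix z assume z: "z \<in> ?M"
    then obtain r where r: "r > 0" "ball z r \<subseteq> W"
      using assms(1) by (auto simp: open_contains_ball)
    have "G constant_on ball z r"
      by (rule maximum_modulus_principle[where U = "ball z r" and \<xi> = z])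
        (use r z w' assms(2) in \<open>auto intro: holomorphic_on_subset\<close>)
    then have "ball z r \<subseteq> ?M"
      using r z by (fastforce simp: constant_on_def)
    with r show "\<exists>e>0. ball z e \<subseteq> ?M" by blast
  qed
  moreover have "w \<in> ?M" using w by auto
  ultimately have "?M = UNIV"
    by (metis (lifting) clopen empty_iff)
  then have "?K = UNIV" using M by blast
  with comp show False
    by (simp add: not_compact_UNIV)
qed

text \<open>\<open>W\<close> is relatively closed in \<open>escape l (Suc n)\<close>, so at a
  boundary point the iterate of order \<open>Suc n\<close> is undefined or has nonpositive imaginary
  part. Orbits from \<open>W\<close> stay in the closed lower half-plane up to time
  \<open>n\<close>, and the last step lifts them to height at most \<open>Im l\<close>.\<close>

lemma no_detached_escape:
  assumes l: "Im l > 0" and "open W" and sub: "W \<subseteq> escape l (Suc n)"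
    and disj: "W \<inter> escape l n = {}"
    and clos: "\<And>z. z \<in> closure W \<Longrightarrow> z \<in> escape l (Suc n) \<Longrightarrow> z \<in> W"
  shows "W = {}"
proof -
  define F where "F = (\<lambda>m. tan_step l ^^ m)"
  \<comment> \<open>\<open>C\<close> bounds \<open>cmod (cos (F m z))\<close> on \<open>W\<close>
    for \<open>m \<le> n\<close>: the orbit is at most \<open>Suc n * Im l\<close> below the real
    axis, and \<open>cmod (cos w) \<le> exp \<bar>Im w\<bar>\<close>.\<close>
  define C where "C = exp (real (Suc n) * Im l)"
  define P where "P = (\<lambda>z. \<Prod>m\<le>n. cmod (cos (F m z)) / C)"
  have C: "C > 0" by (simp add: C_def)
  have dom: "z \<in> iter_dom l m" if "z \<in> W" "m \<le> Suc n" for z m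
    using that sub iter_dom_antimono[of m "Suc n" l] by (auto simp: escape_def)
  have pos: "Im (F (Suc n) z) > 0" if "z \<in> W" for z
    using that sub unfolding F_def escape_def by blast
  have neg: "Im (F m z) \<le> 0" if "z \<in> W" "m \<le> n" for z m
    using that dom[of z m] disj escape_mono[OF l, of m n] by (fastforce simp: F_def escape_def)
  have growth: "Im (F (Suc m) z) \<le> Im l + Im (F m z)" if "z \<in> W" "m \<le> n" for z m
    using Im_tan_step_le[of "F m z" l] neg[OF that] by (simp add: F_def)
  have up: "Im (F (Suc n) z) \<le> Im l" if "z \<in> W" for z
    using growth[of z n] neg[of z n] that by simp
  \<comment> \<open>Downward induction from time \<open>Suc n\<close>, where the imaginary part is
    positive: each step back loses at most \<open>Im l\<close>.\<close>
  have low: "Im (F m z) \<ge> - (real (Suc n) - real m) * Im l" if z: "z \<in> W" and m: "m \<le> Suc n" for z m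
    using m
  proof (induction m rule: inc_induct)
    case base
    then show ?case using pos[OF z] by simp
  next
    case (step m)
    then have "Im (F (Suc m) z) \<le> Im l + Im (F m z)"
      using z growth by simp
    with step.IH show ?case by (simp add: algebra_simps)
  qed
  have cos_le: "cmod (cos (F m z)) / C \<le> 1" if "z \<in> W" "m \<le> n" for z m
  proof -
    have "real m * Im l \<ge> 0" using l by simp
    then have "\<bar>Im (F m z)\<bar> \<le> real (Suc n) * Im l"
      using neg[OF that] low[of z m] that by (simp add: algebra_simps)
    then have "exp \<bar>Im (F m z)\<bar> \<le> C"
      by (simp only: C_def exp_le_cancel_iff)
    moreover have "cmod (cos (F m z)) \<le> exp \<bar>Im (F m z)\<bar>"
      using cmod_cos_le_exp[of 1 "F m z"] by simp
    ultimately have "cmod (cos (F m z)) \<le> C" by linarith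
    with C show ?thesis by simp
  qed
  have P_le: "P z \<le> cmod (cos (F m z)) / C" if "z \<in> W" "m \<le> n" for z m
  proof -
    have "P z = cmod (cos (F m z)) / C * (\<Prod>k\<in>{..n}-{m}. cmod (cos (F k z)) / C)"
      unfolding P_def using that by (intro prod.remove) auto
    also have "\<dots> \<le> cmod (cos (F m z)) / C * 1"
      using cos_le that C by (intro mult_left_mono prod_le_1) auto
    finally show ?thesis by simp
  qed
  have P_le_1: "P z \<le> 1" if "z \<in> W" for z
    using P_le[OF that le0] cos_le[OF that le0] by simp
  have P_pos: "P z > 0" if "z \<in> W" for z
    unfolding P_def using dom[OF that order_refl] C
    by (intro prod_pos) (auto simp: iter_dom_def F_def)
  have far: "cmod (z - \<i>) \<ge> 1" if "z \<in> W" for z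
    using abs_Im_le_cmod[of "z - \<i>"] neg[OF that le0] by (simp add: F_def)
  text \<open>The cosines damp the poles of the iterates and the last factor damps infinity. They are
    independent of \<open>N\<close>, so a bound for all \<open>N\<close> forces the imaginary part to be nonpositive.\<close>
  define G where "G = (\<lambda>(N::nat) z.
    exp (- \<i> * of_nat N * F (Suc n) z) * (\<Prod>m\<le>n. cos (F m z) / of_real C) / (z - \<i>))"
  have norm_G: "cmod (G N z) = exp (N * Im (F (Suc n) z)) * P z / cmod (z - \<i>)" for N z
    using C by (simp add: G_def P_def norm_mult norm_divide prod_norm [symmetric])
  have hol: "F m holomorphic_on W" if "m \<le> Suc n" for m
    unfolding F_def using dom that by (intro holomorphic_on_subset[OF holomorphic_iter]) blast
  have hol_G: "G N holomorphic_on W" for N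
    unfolding G_def using far C
    by (intro holomorphic_intros hol holomorphic_on_compose[of "F _" _ cos, unfolded o_def]) fastforce+
  have G_le: "cmod (G N z) \<le> exp (N * Im (F (Suc n) z)) * P z" if "z \<in> W" for N z
  proof -
    have "z \<noteq> \<i>" using far[OF that] by auto
    then show ?thesis
      unfolding norm_G using far[OF that] P_pos[OF that]
      divide_left_mono[of 1 "cmod (z - \<i>)" "exp (N * Im (F (Suc n) z)) * P z"] by simp
  qed
  \<comment> \<open>Otherwise the superlevel set at some height \<open>a > 1\<close> is nonempty. It
    is bounded because of the factor \<open>1 / (z - \<i>)\<close>, and closed because the norm
    cannot stay above \<open>a\<close> on approach to a boundary point, whether a pole or
    not.\<close>
  have G_le_1: "cmod (G N z) \<le> 1" if z: "z \<in> W" for N z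
  proof (rule ccontr)
    assume gt: "\<not> ?thesis"
    define a where "a = cmod (G N z)"
    have a: "a > 1" using gt by (simp add: a_def)
    let ?K = "{w \<in> W. a \<le> cmod (G N w)}"
    have exp_le: "exp (N * Im (F (Suc n) w)) \<le> exp (N * Im l)" if "w \<in> W" for w
      using up[OF that] by (simp add: mult_left_mono)
    have "bounded ?K"
    proof (rule boundedI)
      fix w assume w: "w \<in> ?K"
      then have "w \<in> W" by simp
      have "1 \<le> cmod (G N w)" using w a by simp
      also have "\<dots> \<le> exp (N * Im l) * 1 / cmod (w - \<i>)"
        unfolding norm_G using exp_le[OF \<open>w \<in> W\<close>] P_le_1[OF \<open>w \<in> W\<close>] P_pos[OF \<open>w \<in> W\<close>]
        by (intro divide_right_mono mult_mono) auto
      finally have "cmod (w - \<i>) \<le> exp (N * Im l)"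
        using far[OF \<open>w \<in> W\<close>] by (simp add: le_divide_eq split: if_splits)
      then show "cmod w \<le> exp (N * Im l) + 1"
        using norm_triangle_sub[of w \<i>] by simp
    qed
    moreover have "closed ?K"
      unfolding closed_sequential_limits
    proof (intro allI impI, elim conjE)
      fix x w
      assume x: "\<forall>k. x k \<in> ?K" and lim: "x \<longlonglongrightarrow> w"
      have xW: "x k \<in> W" and xG: "a \<le> cmod (G N (x k))" for k
        using x by auto
      have w_clos: "w \<in> closure W"
        using xW lim closure_sequential by blast
      have tends: "(\<lambda>k. F m (x k)) \<longlonglongrightarrow> F m w" if "w \<in> iter_dom l m" for m
        using isCont_tendsto_compose[OF isCont_iter[OF that] lim] by (simp add: F_def)
      show "w \<in> ?K"
      proof (cases "w \<in> iter_dom l (Suc n)")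
        case True
        \<comment> \<open>If not, the exponential factor tends to a limit at most 1 while the
          damping factors stay at most 1, contradicting \<open>a > 1\<close>.\<close>
        have "Im (F (Suc n) w) > 0"
        proof (rule ccontr)
          assume "\<not> ?thesis"
          then have le: "exp (N * Im (F (Suc n) w)) \<le> 1"
            by (simp add: mult_nonneg_nonpos)
          have "(\<lambda>k. exp (N * Im (F (Suc n) (x k)))) \<longlonglongrightarrow> exp (N * Im (F (Suc n) w))"
            using tends[OF True] by (intro tendsto_intros)
          moreover have "a \<le> exp (N * Im (F (Suc n) (x k)))" for k
          proof -
            have "a \<le> exp (N * Im (F (Suc n) (x k))) * P (x k)"
              using xG[of k] G_le[OF xW, of N k] by linarith
            also have "\<dots> \<le> exp (N * Im (F (Suc n) (x k))) * 1"
              using P_le_1[OF xW] by (intro mult_left_mono) auto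
            finally show ?thesis by simp
          qed
          ultimately have "a \<le> exp (N * Im (F (Suc n) w))"
            by (intro LIMSEQ_le_const) auto
          with a le show False by simp
        qed
        with True have "w \<in> W"
          using w_clos clos by (simp add: escape_def F_def)
        have "isCont (G N) w"
          using continuous_on_eq_continuous_at[OF \<open>open W\<close>] \<open>w \<in> W\<close>
            holomorphic_on_imp_continuous_on[OF hol_G] by metis
        then have "(\<lambda>k. cmod (G N (x k))) \<longlonglongrightarrow> cmod (G N w)"
          by (rule tendsto_norm[OF isCont_tendsto_compose[OF _ lim]])
        then have "a \<le> cmod (G N w)"
          using xG by (intro LIMSEQ_le_const) auto
        with \<open>w \<in> W\<close> show ?thesis by simp
      next
        case False
        \<comment> \<open>The first pole on the orbit of \<open>w\<close>. \<open>F m\<close> is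
          still continuous at \<open>w\<close>, so \<open>cos (F m (x k))\<close> tends to 0, and by
          \<open>P_le\<close> this single factor forces \<open>G N (x k)\<close> to 0, whatever the
          later iterates do.\<close>
        define m where "m = (LEAST m. m < Suc n \<and> cos (F m w) = 0)"
        have ex: "\<exists>m. m < Suc n \<and> cos (F m w) = 0"
          using False by (auto simp: iter_dom_def F_def)
        have m: "m < Suc n" "cos (F m w) = 0"
          using LeastI_ex[OF ex] by (auto simp: m_def)
        have "cos (F k w) \<noteq> 0" if "k < m" for k
          using not_less_Least[OF that[unfolded m_def]] that m(1) by simp
        then have "w \<in> iter_dom l m"
          by (simp add: iter_dom_def F_def)
        then have "(\<lambda>k. exp (N * Im l) * (cmod (cos (F m (x k))) / C))
            \<longlonglongrightarrow> exp (N * Im l) * (cmod (cos (F m w)) / C)"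
          using C by (intro tendsto_intros isCont_tendsto_compose[OF isCont_cos] tends) auto
        moreover have "a \<le> exp (N * Im l) * (cmod (cos (F m (x k))) / C)" for k
        proof -
          have "a \<le> exp (N * Im (F (Suc n) (x k))) * P (x k)"
            using xG[of k] G_le[OF xW, of N k] by linarith
          also have "\<dots> \<le> exp (N * Im l) * (cmod (cos (F m (x k))) / C)"
            using exp_le[OF xW] P_le[OF xW] m(1) P_pos[OF xW, of k]
            by (intro mult_mono) auto
          finally show ?thesis .
        qed
        ultimately have "a \<le> exp (N * Im l) * (cmod (cos (F m w)) / C)"
          by (intro LIMSEQ_le_const) auto
        with m a show ?thesis by simp
      qed
    qed
    ultimately have "compact ?K"
      by (simp add: compact_eq_bounded_closed)
    then have "?K = {}"
      using no_compact_superlevel_set \<open>open W\<close> hol_G by blast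
    then show False
      using z by (auto simp: a_def)
  qed
  show ?thesis
  proof (rule ccontr)
    assume "W \<noteq> {}"
    then obtain z where z: "z \<in> W" by blast
    let ?c = "P z / cmod (z - \<i>)"
    have c: "?c > 0" using P_pos[OF z] far[OF z] by (intro divide_pos_pos) auto
    have "filterlim (\<lambda>N. real N * Im (F (Suc n) z)) at_top sequentially"
      using pos[OF z]
      by (intro filterlim_at_top_mult_tendsto_pos[OF tendsto_const _ filterlim_real_sequentially])
    then have "filterlim (\<lambda>N. exp (real N * Im (F (Suc n) z))) at_top sequentially"
      by (rule filterlim_compose[OF exp_at_top])
    then have "eventually (\<lambda>N. exp (real N * Im (F (Suc n) z)) > 1 / ?c) sequentially"
      by (simp add: filterlim_at_top_dense)
    then obtain N :: nat where "exp (real N * Im (F (Suc n) z)) > 1 / ?c"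
      using eventually_happens by fastforce
    then have "exp (real N * Im (F (Suc n) z)) * ?c > 1"
      by (simp only: pos_divide_less_eq[OF c])
    with G_le_1[OF z, of N] show False
      by (simp add: norm_G)
  qed
qed

section \<open>Locally uniform escape and normality\<close>

text \<open>By openness and monotonicity a compact set lies in one \<open>escape l N\<close>; after
  time \<open>N\<close> the imaginary parts grow at least linearly, uniformly on the set.\<close>

lemma uniform_limit_escape:
  assumes l: "Im l > 0" and "compact K" "K \<subseteq> (\<Union>n. escape l n)"
  shows "uniform_limit K (\<lambda>n z. chordal (iterate (tan_map l) n z) None) (\<lambda>_. 0) sequentially"
proof -
  obtain N where N: "K \<subseteq> escape l N"
  proof -
    obtain I where I: "finite I" "K \<subseteq> (\<Union>n\<in>I. escape l n)"
      using compactE_image[OF assms(2), of UNIV "escape l"] open_escape assms(3) by metis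
    have "escape l n \<subseteq> escape l (Max (insert 0 I))" if "n \<in> I" for n
      using I that by (intro escape_mono[OF l] Max_ge) auto
    with I show ?thesis by (intro that[of "Max (insert 0 I)"]) blast
  qed
  show ?thesis
    unfolding uniform_limit_iff
  proof (intro allI impI)
    fix e :: real assume e: "e > 0"
    \<comment> \<open>The chordal distance from \<open>w\<close> to infinity is at most
      \<open>2 / cmod w\<close>, hence the threshold \<open>2 / e\<close>.\<close>
    obtain k0 :: nat where k0: "real k0 * Im l > 2 / e"
      using reals_Archimedean3[OF l] by blast
    show "\<forall>\<^sub>F n in sequentially. \<forall>z\<in>K. dist (chordal (iterate (tan_map l) n z) None) 0 < e"
      using eventually_ge_at_top[of "N + k0"]
    proof eventually_elim
      case (elim n)
      show ?case
      proof
        fix z assume "z \<in> K"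
        define w where "w = (tan_step l ^^ n) z"
        have z: "z \<in> escape l n \<and> Im w \<ge> real (n - N) * Im l"
          using escape_add[OF l, of z N "n - N"] N \<open>z \<in> K\<close> elim by (auto simp: w_def)
        then have it: "iterate (tan_map l) n z = Some w"
          by (auto simp: iterate_tan_map escape_def w_def)
        have "real k0 * Im l \<le> real (n - N) * Im l"
          using elim l by (intro mult_right_mono) auto
        then have "2 / e < cmod w"
          using z k0 abs_Im_le_cmod[of w] by linarith
        also have "cmod w \<le> sqrt (1 + (cmod w)\<^sup>2)"
          by (rule real_le_rsqrt) simp
        finally have "2 / e < sqrt (1 + (cmod w)\<^sup>2)" .
        then have "2 / sqrt (1 + (cmod w)\<^sup>2) < e"
          using e by (smt (verit, best) divide_less_eq mult.commute divide_pos_pos)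
        then show "dist (chordal (iterate (tan_map l) n z) None) 0 < e"
          by (simp add: it)
      qed
    qed
  qed
qed

text \<open>A sequence in the family may repeat iterates. Either one order recurs infinitely often
  and gives a constant subsequence, or the orders tend to infinity and the whole sequence tends to
  \<open>None\<close>.\<close>

lemma normal_family_escape:
  assumes l: "Im l > 0"
  shows "normal_family (\<Union>n. escape l n) {iterate (tan_map l) n |n. n > 0}"
  unfolding normal_family_def
proof (intro allI impI)
  fix s :: "nat \<Rightarrow> complex \<Rightarrow> complex option"
  assume "range s \<subseteq> {iterate (tan_map l) n |n. n > 0}"
  then have "\<forall>i. \<exists>k. s i = iterate (tan_map l) k" by blast
  then obtain k where k: "\<And>i. s i = iterate (tan_map l) (k i)" by metis
  show "\<exists>r g. strict_mono (r :: nat \<Rightarrow> nat) \<and> (\<forall>K. compact K \<and> K \<subseteq> (\<Union>n. escape l n) \<longrightarrow>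
    uniform_limit K (\<lambda>n z. chordal (s (r n) z) (g z)) (\<lambda>_. 0) sequentially)"
  proof (cases "\<exists>v. infinite {i. k i = v}")
    case True
    then obtain v where "infinite {i. k i = v}" by blast
    then obtain r where r: "strict_mono (r :: nat \<Rightarrow> nat)" "\<And>n. k (r n) = v"
      using infinite_enumerate[of "{i. k i = v}"] by auto
    have "chordal x x = 0" for x by (cases x) auto
    then have "uniform_limit K (\<lambda>n z. chordal (s (r n) z) (iterate (tan_map l) v z)) (\<lambda>_. 0)
        sequentially" for K
      by (simp add: k r uniform_limit_iff)
    with r show ?thesis by blast
  next
    case False
    have lim: "filterlim k at_top sequentially"
      unfolding filterlim_at_top
    proof
      fix Z
      have "finite (\<Union>v<Z. {i. k i = v})" using False by (intro finite_UN_I) auto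
      then have "finite {i. \<not> Z \<le> k i}"
        by (rule finite_subset[rotated]) auto
      then show "\<forall>\<^sub>F i in sequentially. Z \<le> k i"
        by (simp only: eventually_cofinite flip: cofinite_eq_sequentially)
    qed
    have "uniform_limit K (\<lambda>n z. chordal (s (id n) z) None) (\<lambda>_. 0) sequentially"
      if "compact K \<and> K \<subseteq> (\<Union>n. escape l n)" for K
      using filterlim_compose[OF uniform_limit_escape[OF l, of K] lim] that by (simp add: k)
    then show ?thesis
      by (intro exI[of _ id] exI[of _ "\<lambda>_. None"]) (simp add: strict_mono_def)
  qed
qed

lemma escape_iter_dom:
  assumes "Im l > 0" "z \<in> (\<Union>n. escape l n)"
  shows "z \<in> iter_dom l m"
proof -
  obtain n where "z \<in> escape l n" using assms by blast
  then have "z \<in> escape l (n + m)" using escape_add assms by blast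
  then show ?thesis using iter_dom_antimono[of m "n + m"] by (auto simp: escape_def)
qed

lemma iterate_defined_tan_map:
  "iterate_defined (tan_map l) n z \<longleftrightarrow> (\<forall>m<n. z \<in> iter_dom l m)"
  by (auto simp: iterate_defined_def iterate_tan_map)

lemma escape_subset_fatou:
  assumes "Im l > 0"
  shows "(\<Union>n. escape l n) \<subseteq> fatou_set (tan_map l)"
proof
  fix z assume z: "z \<in> (\<Union>n. escape l n)"
  have "\<forall>n>0. \<forall>w\<in>(\<Union>n. escape l n). iterate_defined (tan_map l) n w"
    using escape_iter_dom[OF assms] by (simp add: iterate_defined_tan_map)
  moreover have "open (\<Union>n. escape l n)"
    using open_escape by auto
  ultimately show "z \<in> fatou_set (tan_map l)"
    unfolding fatou_set_def using z normal_family_escape[OF assms]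
    by (intro CollectI exI[of _ "\<Union>n. escape l n"] conjI)
qed

section \<open>Relative closedness in the Fatou set\<close>

lemma fatou_nbhd_iter_dom:
  assumes "z \<in> fatou_set (tan_map l)"
  obtains V where "open V" "z \<in> V" "\<And>n. V \<subseteq> iter_dom l n"
proof -
  from assms obtain V where V: "open V" "z \<in> V"
      "\<forall>n>0. \<forall>w\<in>V. iterate_defined (tan_map l) n w"
    by (auto simp: fatou_set_def)
  have "V \<subseteq> iter_dom l n" for n
    using V(3)[rule_format, of "Suc n"] by (auto simp: iterate_defined_tan_map)
  with V that show thesis by blast
qed

text \<open>From \<open>exp (- 2 * \<i> * z) + 1 = 2 * exp (- \<i> * z) * cos z\<close>. Avoiding
  the poles thus becomes omitting the value \<open>-1\<close>, which together with 0 gives the two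
  omitted values for \<open>Schottky\<close>.\<close>

lemma exp_cos_zero: "exp (- 2 * \<i> * z) = - 1 \<longleftrightarrow> cos z = (0 :: complex)"
proof -
  have "exp (- \<i> * z) * exp (- \<i> * z) = exp (- 2 * \<i> * z)"
       "exp (- \<i> * z) * exp (\<i> * z) = 1"
    by (simp_all add: mult.assoc flip: exp_add)
  then have eq: "exp (- 2 * \<i> * z) + 1 = 2 * exp (- \<i> * z) * cos z"
    unfolding cos_exp_eq by (simp add: distrib_left mult.assoc)
  have "exp (- 2 * \<i> * z) = - 1 \<longleftrightarrow> exp (- 2 * \<i> * z) + 1 = 0"
    by (rule eq_neg_iff_add_eq_0)
  also have "\<dots> \<longleftrightarrow> cos z = 0"
    unfolding eq by simp
  finally show ?thesis .
qed

lemma escape_relatively_closed: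
  assumes l: "Im l > 0" and z: "z \<in> fatou_set (tan_map l)" "z \<notin> (\<Union>n. escape l n)"
  shows "z \<notin> closure (\<Union>n. escape l n)"
proof -
  obtain V where V: "open V" "z \<in> V" "\<And>n. V \<subseteq> iter_dom l n"
    using fatou_nbhd_iter_dom[OF z(1)] by blast
  then obtain r where r: "r > 0" "cball z r \<subseteq> V"
    using open_contains_cball by blast
  define F where "F = (\<lambda>n. tan_step l ^^ n)"
  \<comment> \<open>The bound of \<open>Schottky\<close> for value at most 1 at the centre and
    radius \<open>1/2\<close>; it depends on neither the iterate nor the point.\<close>
  define M where "M = exp (pi * exp (pi * (2 + 2 * 1 + 12 * (1/2) / (1 - 1/2))))"
  have inV: "z + of_real r * u \<in> V" if "u \<in> cball 0 1" for u
    using that r by (intro subsetD[OF r(2)]) (simp add: dist_norm norm_mult)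
  have bound: "exp (2 * Im (F n w)) \<le> M" if w: "w \<in> ball z (r/2)" for w n
  proof -
    \<comment> \<open>The disc of radius \<open>r\<close> is rescaled to the unit disc, and the sign
      turns the omitted value \<open>-1\<close> into 1. The norm of \<open>h\<close> is
      \<open>exp (2 * Im (F n _))\<close>.\<close>
    define h where "h = (\<lambda>u. - exp (- 2 * \<i> * F n (z + of_real r * u)))"
    define u where "u = (w - z) / of_real r"
    have "F n holomorphic_on V"
      unfolding F_def using V(3) by (intro holomorphic_on_subset[OF holomorphic_iter])
    moreover have "(\<lambda>u. z + of_real r * u) holomorphic_on cball 0 1"
      by (intro holomorphic_intros)
    moreover have "(\<lambda>u. z + of_real r * u) ` cball 0 1 \<subseteq> V"
      using inV by blast
    ultimately have "(\<lambda>u. F n (z + of_real r * u)) holomorphic_on cball 0 1"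
      using holomorphic_on_compose_gen[of "\<lambda>u. z + of_real r * u" "cball 0 1" "F n" V]
      by (simp add: o_def)
    then have "h holomorphic_on cball 0 1"
      unfolding h_def by (intro holomorphic_intros)
    \<comment> \<open>The centre \<open>z\<close> never enters the upper half-plane, so
      \<open>Im (F n z) \<le> 0\<close>.\<close>
    moreover have "cmod (h 0) \<le> 1"
      using z V(2) V(3)[of n] by (auto simp: h_def F_def escape_def not_less)
    moreover have "\<not> (h x = 0 \<or> h x = 1)" if "x \<in> cball 0 1" for x
    proof -
      have "cos (F n (z + of_real r * x)) \<noteq> 0"
        using inV[OF that] V(3)[of "Suc n"] by (auto simp: F_def iter_dom_Suc)
      then show ?thesis
        using exp_cos_zero[of "F n (z + of_real r * x)"] by (simp add: h_def minus_equation_iff)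
    qed
    moreover have "norm u \<le> 1/2"
      using w r(1) by (simp add: u_def norm_divide dist_norm norm_minus_commute field_simps)
    ultimately have "norm (h u) \<le> M"
      unfolding M_def by (intro Schottky) auto
    then show ?thesis
      using r(1) by (simp add: h_def u_def)
  qed
  have "w \<notin> escape l n" if w: "w \<in> ball z (r/2)" for w n
  proof
    assume esc: "w \<in> escape l n"
    have M: "M > 0" by (simp add: M_def)
    obtain k :: nat where k: "real k * Im l > ln M"
      using reals_Archimedean3[OF l] by blast
    have "real k * Im l \<ge> 0" using l by simp
    then have "ln M < 2 * Im (F (n + k) w)"
      using escape_add[OF l esc, of k] k unfolding F_def by linarith
    then have "exp (ln M) < exp (2 * Im (F (n + k) w))"
      by (simp only: exp_less_cancel_iff)
    with bound[OF w, of "n + k"] M show False by simp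
  qed
  then have "ball z (r/2) \<inter> (\<Union>n. escape l n) = {}" by blast
  then have "ball z (r/2) \<inter> closure (\<Union>n. escape l n) = {}"
    by (simp only: open_Int_closure_eq_empty[OF open_ball])
  moreover have "z \<in> ball z (r/2)" using r(1) by simp
  ultimately show ?thesis by blast
qed

section \<open>The essential singularity at infinity\<close>

text \<open>Two real sequences tending to infinity exclude a limit: poles, with value
  \<open>None\<close>, and solutions of \<open>x + tan x = 0\<close>, with value
  \<open>Some l\<close>.\<close>

lemma essential_singularity_tan_map: "essential_singularity_at_infinity (tan_map l)"
  unfolding essential_singularity_at_infinity_def
proof
  assume "\<exists>L. ((\<lambda>z. chordal (tan_map l z) L) \<longlongrightarrow> 0) at_infinity"
  then obtain L where L: "((\<lambda>z. chordal (tan_map l z) L) \<longlongrightarrow> 0) at_infinity" by blast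
  have along: "chordal c L = 0"
    if "\<And>k. tan_map l (of_real (x k)) = c" "\<And>k. x k \<ge> real k" for x :: "nat \<Rightarrow> real" and c
  proof -
    have "filterlim x at_top sequentially"
      by (rule filterlim_at_top_mono[OF filterlim_real_sequentially]) (use that(2) in auto)
    then have "filterlim (\<lambda>k. complex_of_real (x k)) at_infinity sequentially"
      using filterlim_compose[OF filterlim_of_real_at_infinity] by blast
    from filterlim_compose[OF L this] have "(\<lambda>k::nat. chordal c L) \<longlonglongrightarrow> 0"
      by (simp add: that)
    then show ?thesis by (simp add: LIMSEQ_const_iff)
  qed
  have "chordal None L = 0"
  proof (rule along)
    fix k :: nat
    show "tan_map l (of_real (real k * pi + pi / 2)) = None"
      unfolding tan_map_eq
      by (simp flip: cos_of_real add: cos_add)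
    have "real k * 1 \<le> real k * pi" using pi_gt3 by (intro mult_left_mono) auto
    then show "real k \<le> real k * pi + pi / 2" using pi_gt3 by linarith
  qed
  moreover have "\<exists>x. x \<ge> real k \<and> tan_map l (of_real x) = Some l" for k
  proof -
    let ?p = "real (Suc k) * pi"
    \<comment> \<open>With this endpoint \<open>y + ?p + tan (y + ?p)\<close> equals
      \<open>?a < 0\<close> at \<open>y = ?a\<close> and \<open>?p > 0\<close> at
      \<open>y = 0\<close>, with no pole between. \<open>Suc k\<close> leaves room for
      \<open>y > - pi / 2\<close>.\<close>
    let ?a = "arctan (- ?p)"
    have p: "?p > 0" by simp
    then have a: "?a < 0" by (simp only: arctan_less_zero_iff neg_less_0_iff_less)
    have cos: "cos (y + ?p) \<noteq> 0" if "?a \<le> y" "y \<le> 0" for y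
    proof -
      have "cos (y + ?p) = cos y * (- 1) ^ Suc k"
        by (simp only: cos_add sin_npi cos_npi mult_zero_right diff_zero)
      moreover have "cos y > 0"
        using that arctan_lbound[of "- ?p"] by (intro cos_gt_zero_pi) auto
      ultimately show ?thesis by simp
    qed
    have tan_p: "tan (y + ?p) = tan y" for y
      by (rule tan_periodic_nat)
    have "continuous_on {?a..0} (\<lambda>y. y + ?p + tan (y + ?p))"
      using cos by (intro continuous_intros) auto
    moreover have "?a + ?p + tan (?a + ?p) \<le> 0"
      unfolding tan_p tan_arctan using a by linarith
    moreover have "0 \<le> 0 + ?p + tan (0 + ?p)"
      using p by (simp only: tan_p) simp
    ultimately obtain y where y: "?a \<le> y" "y \<le> 0" "y + ?p + tan (y + ?p) = 0"
      using IVT'[of "\<lambda>y. y + ?p + tan (y + ?p)" ?a 0 0] a by auto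
    have "real k * 1 \<le> real k * pi" using pi_gt3 by (intro mult_left_mono) auto
    moreover have "?p = real k * pi + pi" by (simp add: algebra_simps)
    ultimately have "y + ?p \<ge> real k"
      using y(1) arctan_lbound[of "- ?p"] pi_gt_zero by linarith
    moreover have "tan_map l (of_real (y + ?p)) = Some l"
    proof -
      have "cos (complex_of_real (y + ?p)) \<noteq> 0"
        using cos[OF y(1,2)] unfolding cos_of_real of_real_eq_0_iff .
      moreover have "complex_of_real (y + ?p) + tan (complex_of_real (y + ?p)) = of_real 0"
        unfolding y(3)[symmetric] by (simp only: of_real_add tan_of_real)
      ultimately show ?thesis by (simp add: tan_map_eq add.assoc)
    qed
    ultimately show ?thesis by blast
  qed
  then obtain x where "\<And>k. x k \<ge> real k \<and> tan_map l (of_real (x k)) = Some l" by metis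
  then have "chordal (Some l) L = 0" by (intro along) auto
  ultimately show False
    by (cases L) (auto simp: add_nonneg_eq_0_iff)
qed

section \<open>The escaping set as a Fatou component\<close>

lemma connected_escape:
  assumes l: "Im l > 0"
  shows "connected (\<Union>n. escape l n)"
proof -
  define V where "V = (\<Union>n. escape l n)"
  define C where "C = connected_component_set V \<i>"
  have V: "open V" using open_escape by (auto simp: V_def)
  have openC: "open C" using V by (simp add: C_def open_connected_component)
  \<comment> \<open>Components of \<open>V\<close> are relatively closed in \<open>V\<close>; hence
    the part of each \<open>escape l (Suc n)\<close> outside \<open>C\<close> is open, as
    \<open>no_detached_escape\<close> requires.\<close>
  have openVC: "open (V - C)"
    using openin_diff[OF openin_subtopology_self closedin_connected_component[of V \<i>]] V
    by (simp add: C_def openin_open_eq)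
  have "escape l n \<subseteq> C" for n
  proof (induction n)
    case 0
    have "connected (escape l 0)"
      using convex_halfspace_Im_gt[of 0] by (simp add: escape_0 convex_connected)
    moreover have "\<i> \<in> escape l 0" by (simp add: escape_0)
    moreover have "escape l 0 \<subseteq> V" by (auto simp: V_def)
    ultimately show ?case
      unfolding C_def by (intro connected_component_maximal)
  next
    case (Suc n)
    define W where "W = escape l (Suc n) - C"
    have sub: "escape l (Suc n) \<subseteq> V" by (auto simp: V_def)
    have "W = escape l (Suc n) \<inter> (V - C)" using sub by (auto simp: W_def)
    then have "open W" using openVC open_escape by auto
    moreover have "z \<in> W" if "z \<in> closure W" "z \<in> escape l (Suc n)" for z
    proof -
      have "C \<inter> closure W = {}"
        using open_Int_closure_eq_empty[OF openC, of W] by (auto simp: W_def)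
      with that show ?thesis by (auto simp: W_def)
    qed
    ultimately have "W = {}"
      using Suc by (intro no_detached_escape[OF l, of W n]) (auto simp: W_def)
    then show ?case by (auto simp: W_def)
  qed
  then have "V = C"
    using connected_component_subset[of V \<i>] by (auto simp: V_def C_def)
  then show ?thesis
    unfolding V_def[symmetric] using connected_connected_component[of V \<i>] C_def by metis
qed

text \<open>By relative closedness the Fatou component of \<open>\<i>\<close> is covered by two
  disjoint open sets, the escaping set and the complement of its closure; connectedness leaves only
  the first.\<close>

lemma escape_in_components:
  assumes l: "Im l > 0"
  shows "(\<Union>n. escape l n) \<in> components (fatou_set (tan_map l))"
proof -
  let ?V = "\<Union>n. escape l n" and ?F = "fatou_set (tan_map l)"
  have sub: "?V \<subseteq> ?F" by (rule escape_subset_fatou[OF l])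
  have "\<i> \<in> escape l 0" by (simp add: escape_0)
  then have i: "\<i> \<in> ?V" by blast
  define C where "C = connected_component_set ?F \<i>"
  have C: "C \<subseteq> ?F" "connected C" "?V \<subseteq> C"
    using connected_component_maximal[OF i connected_escape[OF l] sub]
    by (simp_all add: C_def connected_component_subset)
  define E where "E = - closure ?V"
  have "open E" by (simp add: E_def open_Compl)
  have E: "C - ?V \<subseteq> E"
    using escape_relatively_closed[OF l] C(1) unfolding E_def by blast
  have "open ?V" using open_escape by auto
  moreover have "?V \<inter> E \<inter> C = {}" using closure_subset[of ?V] unfolding E_def by blast
  moreover have "C \<subseteq> ?V \<union> E" using E by blast
  moreover have "?V \<inter> C \<noteq> {}" using i C(3) by blast
  ultimately have "E \<inter> C = {}"
    using connectedD[OF C(2), of ?V E] \<open>open E\<close> by blast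
  with E C(3) have "C = ?V" by blast
  moreover have "C \<in> components ?F"
    using i sub by (auto simp: C_def components_def)
  ultimately show ?thesis by simp
qed

theorem theorem1p1:
  fixes l :: complex
  assumes "Im l > 0"
  shows "\<exists>B. completely_invariant_component (tan_map l) B \<and> baker_domain (tan_map l) B \<and>
    {z. Im z > 0} \<subseteq> B"
proof -
  define B where "B = (\<Union>n. escape l n)"
  have comp: "fatou_component (tan_map l) B"
    using escape_in_components[OF assms] by (simp add: fatou_component_def B_def)
  have backward: "z \<in> B" if "cos z \<noteq> 0" "tan_step l z \<in> B" for z
    using that escape_Suc_iff[of z l] by (auto simp: B_def)
  have forward: "cos z \<noteq> 0 \<and> tan_step l z \<in> B" if z: "z \<in> B" for z
  proof -
    obtain n where "z \<in> escape l n" using z by (auto simp: B_def)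
    \<comment> \<open>Raising the index covers \<open>n = 0\<close>, so that a first step can be
      split off.\<close>
    then have "z \<in> escape l (Suc n)" using escape_mono[OF assms, of n "Suc n"] by auto
    then show ?thesis by (auto simp: B_def escape_Suc_iff)
  qed
  have inv: "invariant_component (tan_map l) B"
    using comp forward
    by (auto simp: invariant_component_def is_fatou_image_def tan_map_eq_step)
  moreover have "tan_map l -` (Some ` B) \<subseteq> B"
    using backward by (auto simp: tan_map_eq_step split: if_splits)
  moreover have "baker_domain (tan_map l) B"
    using inv essential_singularity_tan_map uniform_limit_escape[OF assms]
    by (simp add: baker_domain_def B_def)
  moreover have "{z. Im z > 0} \<subseteq> B"
    using escape_0[of l] by (auto simp: B_def)
  ultimately show ?thesis
    by (auto simp: completely_invariant_component_def)
qed

end
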